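(* Let $P_1,P_2\subseteq\mathbb{R}_{\max}^n$ be compact tropical polyhedra, and suppose that $P_2$ has greatest point $y^{\max}\in P_2$ with all components in $\mathbb{R}$. Define $x^*\in\mathbb{R}^n$ by $x_i^*=\sum_{k\ne i}y_k^{\max}$ (ordinary sum). For $I,J$ with $I\cup J=[n]$ and $I\cap J=\emptyset$ let $$P_1^{IJ}=\{x\in P_1 : x_j-x_j^*<x_i-x_i^*\ \ \forall i\in I,\ j\in J;\quad x_k-x_k^*=x_l-x_l^*\ \ \forall k,l\in I\},$$ $$P_2^{IJ}=\Big\{y\in P_2 : \max_{i\in I}\Big(\sum_{k\neq i}y_k^{\max}+y_i\Big)=\sum_{k\in[n]}y_k^{\max}\Big\}.$$ Then $$\{(x,y)\in P_1\times P_2 : x^Ty=x^Ty^{\max}\}=\bigcup_{I,J}\ P_1^{IJ}\times P_2^{IJ},$$ where the union is over all $I,J$ with $I\cap J=\emptyset$ and $I\cup J=[n]$.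
   Context: $\mathbb{R}_{\max}=\mathbb{R}\cup\{-\infty\}$ with $a\oplus b=\max(a,b)$ and $a\otimes b=a+b$ (with $-\infty+a=-\infty$ for all $a$). For $x,y\in\mathbb{R}_{\max}^n$, $x^Ty$ denotes the tropical scalar product $\max_{1\le i\le n}(x_i+y_i)$. $[n]=\{1,\dots,n\}$. A maximum over the empty set is $-\infty$. A tropical polyhedron in $\mathbb{R}_{\max}^n$ is an intersection of finitely many tropical affine halfspaces, i.e. sets of the form $\{x\in\mathbb{R}_{\max}^n : a^Tx\oplus\alpha\le b^Tx\oplus\beta\}$ with $a,b\in\mathbb{R}_{\max}^n$, $\alpha,\beta\in\mathbb{R}_{\max}$. Compactness is with respect to the metric $\rho(x,y)=\max_i|e^{x_i}-e^{y_i}|$ (with $e^{-\infty}=0$). The greatest point $y^{\max}$ of $P_2$ is the point of $P_2$ with $y\le y^{\max}$ componentwise for all $y\in P_2$.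
   Formalization: The printed equality fails if P_1 contains (-∞,…,-∞) (e.g. n=1, P_1={-∞}, P_2=[0,1]); it is proved when P_1 omits this point, and for every P_1 with the piece (P_1∩{(-∞,…,-∞)})×P_2 added to the right-hand side. *)

theory Defs
  imports "HOL-Analysis.Analysis"
begin

text \<open>
  The tropical semiring \<open>\<real> \<union> {-\<infinity>}\<close> is the part of \<^typ>\<open>ereal\<close> without \<open>\<infinity>\<close>: the order, the sum and
  \<open>-\<infinity> + a = -\<infinity>\<close> are then those of \<^typ>\<open>ereal\<close>. Maxima are suprema in \<^typ>\<open>ereal\<close>, so over a
  finite nonempty set they are maxima, and over the empty set they are \<open>-\<infinity>\<close>.
\<close>

definition rmax_space :: "(ereal ^ 'n) set" where
  "rmax_space = {x. \<forall>i. x $ i \<noteq> \<infinity>}"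

text \<open>
  The point with all coordinates \<open>-\<infinity>\<close> has to be singled out: for \<open>x = trop_bot\<close> the equation
  \<open>x\<^sup>Ty = x\<^sup>Ty\<^sup>m\<^sup>a\<^sup>x\<close> reads \<open>-\<infinity> = -\<infinity>\<close> and holds for every \<open>y\<close>, whereas the cells only pair \<open>x\<close> with those
  \<open>y\<close> that agree with \<open>y\<^sup>m\<^sup>a\<^sup>x\<close> in some coordinate.
\<close>

definition trop_bot :: "ereal ^ 'n" where
  "trop_bot = (\<chi> i. -\<infinity>)"

definition trop_inner :: "ereal ^ 'n \<Rightarrow> ereal ^ 'n \<Rightarrow> ereal" where
  "trop_inner x y = (SUP i. x $ i + y $ i)"

definition trop_halfspace :: "(ereal ^ 'n) set \<Rightarrow> bool" where
  "trop_halfspace H \<longleftrightarrow> (\<exists>a \<in> rmax_space. \<exists>b \<in> rmax_space. \<exists>\<alpha> \<beta>. \<alpha> \<noteq> \<infinity> \<and> \<beta> \<noteq> \<infinity> \<and>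
     H = {x \<in> rmax_space. max (trop_inner a x) \<alpha> \<le> max (trop_inner b x) \<beta>})"

definition trop_polyhedron :: "(ereal ^ 'n) set \<Rightarrow> bool" where
  "trop_polyhedron P \<longleftrightarrow>
     (\<exists>\<H>. finite \<H> \<and> (\<forall>H \<in> \<H>. trop_halfspace H) \<and> P = rmax_space \<inter> \<Inter>\<H>)"

definition rmax_exp :: "ereal \<Rightarrow> real" where
  "rmax_exp a = (if a = -\<infinity> then 0 else exp (real_of_ereal a))"

definition trop_dist :: "ereal ^ 'n::finite \<Rightarrow> ereal ^ 'n \<Rightarrow> real" where
  "trop_dist x y = (MAX i. \<bar>rmax_exp (x $ i) - rmax_exp (y $ i)\<bar>)"

lemma rmax_exp_inj:
  assumes "a \<noteq> \<infinity>" "b \<noteq> \<infinity>" "rmax_exp a = rmax_exp b"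
  shows "a = b"
  using assms by (cases a; cases b) (auto simp: rmax_exp_def)

text \<open>The function \<^const>\<open>trop_dist\<close> is a metric on \<^const>\<open>rmax_space\<close> (not on all of \<open>ereal ^ 'n\<close>),
  so that its metric topology is the intended one.\<close>

lemma Metric_space_trop: "Metric_space (rmax_space :: (ereal ^ 'n::finite) set) trop_dist"
proof
  fix x y :: "ereal ^ 'n"
  have "0 \<le> \<bar>rmax_exp (x $ i) - rmax_exp (y $ i)\<bar>" for i by simp
  then show "0 \<le> trop_dist x y"
    unfolding trop_dist_def by (meson Max_ge_iff finite_class.finite_UNIV finite_imageI
        image_is_empty UNIV_not_empty rangeI)
  show "trop_dist x y = trop_dist y x"
    unfolding trop_dist_def by (simp add: abs_minus_commute)
next
  fix x y :: "ereal ^ 'n"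
  assume xy: "x \<in> rmax_space" "y \<in> rmax_space"
  show "trop_dist x y = 0 \<longleftrightarrow> x = y"
  proof
    assume d: "trop_dist x y = 0"
    have "\<bar>rmax_exp (x $ i) - rmax_exp (y $ i)\<bar> \<le> trop_dist x y" for i
      unfolding trop_dist_def by (rule Max_ge) auto
    with d have "rmax_exp (x $ i) = rmax_exp (y $ i)" for i by simp
    with xy show "x = y"
      by (auto simp: vec_eq_iff rmax_space_def intro: rmax_exp_inj)
  qed (simp add: trop_dist_def)
next
  fix x y z :: "ereal ^ 'n"
  have *: "\<bar>rmax_exp (u $ i) - rmax_exp (v $ i)\<bar> \<le> trop_dist u v" for u v :: "ereal ^ 'n" and i
    unfolding trop_dist_def by (rule Max_ge) auto
  have "\<bar>rmax_exp (x $ i) - rmax_exp (z $ i)\<bar> \<le> trop_dist x y + trop_dist y z" for i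
    using *[of x i y] *[of y i z] by linarith
  then show "trop_dist x z \<le> trop_dist x y + trop_dist y z"
    by (subst trop_dist_def) (auto intro!: Max.boundedI)
qed

definition trop_compact :: "(ereal ^ 'n::finite) set \<Rightarrow> bool" where
  "trop_compact S \<longleftrightarrow> compactin (Metric_space.mtopology rmax_space trop_dist) S"

definition greatest_point :: "(ereal ^ 'n) set \<Rightarrow> ereal ^ 'n \<Rightarrow> bool" where
  "greatest_point P z \<longleftrightarrow> z \<in> P \<and> (\<forall>y \<in> P. \<forall>i. y $ i \<le> z $ i)"

definition xstar :: "ereal ^ 'n::finite \<Rightarrow> ereal ^ 'n" where
  "xstar ymax = (\<chi> i. \<Sum>k \<in> UNIV - {i}. ymax $ k)"

definition P1_cell :: "(ereal ^ 'n::finite) set \<Rightarrow> ereal ^ 'n \<Rightarrow> 'n set \<Rightarrow> 'n set \<Rightarrow> (ereal ^ 'n) set" where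
  "P1_cell P1 ymax I J = {x \<in> P1.
     (\<forall>i \<in> I. \<forall>j \<in> J. x $ j - xstar ymax $ j < x $ i - xstar ymax $ i) \<and>
     (\<forall>k \<in> I. \<forall>l \<in> I. x $ k - xstar ymax $ k = x $ l - xstar ymax $ l)}"

text \<open>The set \<open>J\<close> does not occur on the right; it is kept only as the second index.\<close>

definition P2_cell :: "(ereal ^ 'n::finite) set \<Rightarrow> ereal ^ 'n \<Rightarrow> 'n set \<Rightarrow> 'n set \<Rightarrow> (ereal ^ 'n) set" where
  "P2_cell P2 ymax I J = {y \<in> P2.
     (SUP i \<in> I. (\<Sum>k \<in> UNIV - {i}. ymax $ k) + y $ i) = (\<Sum>k \<in> UNIV. ymax $ k)}"

end

theory Submission
  imports Defs
begin

text \<open>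
  Write \<open>S\<close> for the sum of the coordinates of \<open>y\<^sup>m\<^sup>a\<^sup>x\<close>. Then \<open>x\<^sub>i - x\<^sub>i\<^sup>* = (x\<^sub>i + y\<^sub>i\<^sup>m\<^sup>a\<^sup>x) - S\<close>, so the
  cell of \<open>x\<close> with \<open>I \<noteq> {}\<close> says that \<open>I\<close> is the set of indices where the maximum \<open>x\<^sup>Ty\<^sup>m\<^sup>a\<^sup>x\<close> is attained.
  Likewise the cell of \<open>y\<close> says that \<open>y\<^sub>i = y\<^sub>i\<^sup>m\<^sup>a\<^sup>x\<close> for some \<open>i \<in> I\<close>. Since \<open>y \<le> y\<^sup>m\<^sup>a\<^sup>x\<close>, the maximum
  \<open>x\<^sup>Ty\<close> equals \<open>x\<^sup>Ty\<^sup>m\<^sup>a\<^sup>x\<close> exactly when such an \<open>i\<close> exists, provided that \<open>x\<^sup>Ty\<^sup>m\<^sup>a\<^sup>x\<close> is finite.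
\<close>

lemma trop_inner_attained:
  fixes x y :: "ereal ^ 'n::finite"
  obtains i where "trop_inner x y = x $ i + y $ i"
proof -
  have "trop_inner x y = Max (range (\<lambda>i. x $ i + y $ i))"
    unfolding trop_inner_def by (rule cSup_eq_Max) auto
  also have "\<dots> \<in> range (\<lambda>i. x $ i + y $ i)"
    by (rule Max_in) auto
  finally show thesis using that by auto
qed

lemma trop_inner_upper: "x $ i + y $ i \<le> trop_inner x y"
  unfolding trop_inner_def by (rule SUP_upper) simp

lemma trop_inner_mono:
  assumes "\<And>i. y $ i \<le> z $ i"
  shows "trop_inner x y \<le> trop_inner x z"
  unfolding trop_inner_def using assms by (intro SUP_mono) (auto intro: add_left_mono)

text \<open>A non-bottom \<open>x\<close> has a coordinate above -\<infinity>, which bounds the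
  maximum from below because \<open>z\<close> is real. A real maximum is what later allows
  cancelling a coordinate of \<open>x\<close>.\<close>

lemma trop_inner_finite:
  fixes x :: "ereal ^ 'n::finite"
  assumes "x \<in> rmax_space" and "x \<noteq> trop_bot" and z: "\<And>i. z $ i = ereal (v i)"
  obtains r where "trop_inner x z = ereal r"
proof -
  obtain j where "x $ j \<noteq> -\<infinity>"
    using assms(2) by (auto simp: trop_bot_def vec_eq_iff)
  with z have "x $ j + z $ j \<noteq> -\<infinity>" by (cases "x $ j") auto
  with trop_inner_upper[of x j z] have "trop_inner x z \<noteq> -\<infinity>" by auto
  moreover obtain i where "trop_inner x z = x $ i + z $ i" by (rule trop_inner_attained)
  with assms(1) z have "trop_inner x z \<noteq> \<infinity>" by (auto simp: rmax_space_def)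
  ultimately show thesis using that by (cases "trop_inner x z") auto
qed

lemma sum_except:
  fixes f :: "'n::finite \<Rightarrow> 'a::ab_group_add"
  shows "sum f (UNIV - {i}) = sum f UNIV - f i"
  by (simp add: sum_diff1)

text \<open>Since \<open>xstar z $ i\<close> is the full sum minus \<open>v i\<close>, subtracting
  it adds \<open>z $ i\<close> up to a real shift that does not depend on \<open>i\<close>.
  Comparisons between coordinates do not see this shift.\<close>

lemma minus_xstar:
  assumes z: "\<And>i. z $ i = ereal (v i)"
  shows "x $ i - xstar z $ i = x $ i + z $ i - ereal (sum v UNIV)"
  by (cases "x $ i") (auto simp: xstar_def z sum_except)

lemma P1_cell_iff:
  assumes z: "\<And>i. z $ i = ereal (v i)"
  shows "x \<in> P1_cell P z I J \<longleftrightarrow> x \<in> P \<and>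
    (\<forall>i \<in> I. \<forall>j \<in> J. x $ j + z $ j < x $ i + z $ i) \<and>
    (\<forall>k \<in> I. \<forall>l \<in> I. x $ k + z $ k = x $ l + z $ l)"
proof -
  have less: "a - ereal r < b - ereal r \<longleftrightarrow> a < b" for a b r
    by (cases a; cases b) auto
  have eq: "a - ereal r = b - ereal r \<longleftrightarrow> a = b" for a b r
    by (cases a; cases b) auto
  show ?thesis
    by (simp add: P1_cell_def minus_xstar[OF z] less eq)
qed

lemma P2_cell_iff:
  fixes z :: "ereal ^ 'n::finite"
  assumes z: "\<And>i. z $ i = ereal (v i)"
    and le: "\<forall>y \<in> P. \<forall>i. y $ i \<le> z $ i"
  shows "y \<in> P2_cell P z I J \<longleftrightarrow> y \<in> P \<and> (\<exists>i \<in> I. y $ i = z $ i)"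
proof (cases "y \<in> P")
  case True
  define S where "S = sum v UNIV"
  define g where "g i = ereal (S - v i) + y $ i" for i
  have S: "(\<Sum>k\<in>UNIV. z $ k) = ereal S"
    and g: "(\<Sum>k\<in>UNIV - {i}. z $ k) + y $ i = g i" for i
    by (simp_all add: z S_def g_def sum_except)
  \<comment> \<open>\<open>g i\<close> is the full sum with its \<open>i\<close>-th term lowered
    from \<open>z $ i\<close> to \<open>y $ i\<close>.\<close>
  have g_le: "g i \<le> ereal S" and g_eq: "g i = ereal S \<longleftrightarrow> y $ i = z $ i" for i
    using bspec[OF le True, THEN spec, of i] by (cases "y $ i"; force simp: g_def z)+
  have "(SUP i\<in>I. g i) = ereal S \<longleftrightarrow> (\<exists>i\<in>I. g i = ereal S)"
  proof
    assume sup: "(SUP i\<in>I. g i) = ereal S"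
    \<comment> \<open>The empty supremum is -\<infinity>, whereas \<open>S\<close> is real; over a
      finite nonempty \<open>I\<close> the supremum is attained.\<close>
    then have "I \<noteq> {}" by (auto simp: bot_ereal_def)
    then have "(SUP i\<in>I. g i) \<in> g ` I"
      by (subst cSup_eq_Max) (auto intro: Max_in)
    with sup show "\<exists>i\<in>I. g i = ereal S" by auto
  next
    assume "\<exists>i\<in>I. g i = ereal S"
    then obtain i where "i \<in> I" "g i = ereal S" by blast
    then show "(SUP i\<in>I. g i) = ereal S"
      using g_le by (intro antisym SUP_least) (auto intro: SUP_upper2)
  qed
  with True show ?thesis by (simp add: P2_cell_def S g g_eq)
qed (simp add: P2_cell_def)

lemma trop_inner_eq_iff:
  fixes x y z :: "ereal ^ 'n::finite"
  assumes x: "x \<in> rmax_space" and z: "\<And>i. z $ i = ereal (v i)"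
    and le: "\<And>i. y $ i \<le> z $ i"
  shows "trop_inner x y = trop_inner x z \<longleftrightarrow>
    x = trop_bot \<or> (\<exists>i. y $ i = z $ i \<and> x $ i + z $ i = trop_inner x z)"
proof (cases "x = trop_bot")
  case True
  \<comment> \<open>This matters because -\<infinity> + \<infinity> = \<infinity> in
    \<open>ereal\<close>.\<close>
  have "y $ i \<noteq> \<infinity>" for i using le[of i] z[of i] by auto
  then have "x $ i + y $ i = x $ i + z $ i" for i
    using True z[of i] by (simp add: trop_bot_def)
  then show ?thesis using True by (simp add: trop_inner_def)
next
  case False
  from x False z obtain r where r: "trop_inner x z = ereal r"
    by (rule trop_inner_finite)
  show ?thesis
  proof
    assume eq: "trop_inner x y = trop_inner x z"
    \<comment> \<open>At a maximiser \<open>i\<close> for \<open>y\<close>, the chain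
      \<open>x $ i + y $ i\<close> \<le> \<open>x $ i + z $ i\<close> \<le>
      \<open>trop_inner x z\<close> has equal ends. As their value is the real \<open>r\<close>,
      \<open>x $ i\<close> is real and cancels.\<close>
    obtain i where i: "trop_inner x y = x $ i + y $ i" by (rule trop_inner_attained)
    have "x $ i + y $ i \<le> x $ i + z $ i" using le by (rule add_left_mono)
    with i eq trop_inner_upper[of x i z] have *: "x $ i + z $ i = trop_inner x z" by auto
    with i eq r z have "y $ i = z $ i"
      by (cases "x $ i"; cases "y $ i") auto
    with * show "x = trop_bot \<or> (\<exists>i. y $ i = z $ i \<and> x $ i + z $ i = trop_inner x z)" by blast
  next
    assume "x = trop_bot \<or> (\<exists>i. y $ i = z $ i \<and> x $ i + z $ i = trop_inner x z)"
    with False obtain i where "y $ i = z $ i" "x $ i + z $ i = trop_inner x z" by blast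
    then have "x $ i + y $ i = trop_inner x z" by simp
    with trop_inner_upper[of x i y] trop_inner_mono[of y z x] le
    show "trop_inner x y = trop_inner x z" by auto
  qed
qed

text \<open>The cell of \<open>y\<close> supplies an index of \<open>I\<close> where
  \<open>y\<close> meets \<open>z\<close>, and the cell of \<open>x\<close> makes every index of
  \<open>I\<close> a maximiser.\<close>

lemma ex_cell_iff:
  fixes x y z :: "ereal ^ 'n::finite"
  assumes z: "\<And>i. z $ i = ereal (v i)" and le: "\<forall>y \<in> Q. \<forall>i. y $ i \<le> z $ i"
    and "x \<in> P" and "y \<in> Q"
  shows "(\<exists>I J. I \<inter> J = {} \<and> I \<union> J = UNIV \<and> x \<in> P1_cell P z I J \<and> y \<in> P2_cell Q z I J) \<longleftrightarrow>
    (\<exists>i. y $ i = z $ i \<and> x $ i + z $ i = trop_inner x z)" (is "?L \<longleftrightarrow> ?R")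
proof
  assume ?L
  then obtain I J i where IJ: "I \<union> J = UNIV" and i: "i \<in> I" "y $ i = z $ i"
    and less: "\<forall>i \<in> I. \<forall>j \<in> J. x $ j + z $ j < x $ i + z $ i"
    and eq: "\<forall>k \<in> I. \<forall>l \<in> I. x $ k + z $ k = x $ l + z $ l"
    unfolding P1_cell_iff[OF z] P2_cell_iff[OF z le] by blast
  obtain j where j: "trop_inner x z = x $ j + z $ j" by (rule trop_inner_attained)
  have "x $ j + z $ j \<le> x $ i + z $ i"
  proof (cases "j \<in> I")
    case True
    with i eq show ?thesis by (metis order.refl)
  next
    case False
    with IJ have "j \<in> J" by blast
    with i less show ?thesis by (blast intro: order.strict_implies_order)
  qed
  with j trop_inner_upper[of x i z] have "x $ i + z $ i = trop_inner x z" by auto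
  with i show ?R by blast
next
  assume ?R
  then obtain i where i: "y $ i = z $ i" "x $ i + z $ i = trop_inner x z" by blast
  \<comment> \<open>All maximisers must be taken: one left in the complement would break the strict
    inequalities.\<close>
  define I where "I = {k. x $ k + z $ k = trop_inner x z}"
  have "x $ j + z $ j < trop_inner x z" if "j \<notin> I" for j
    using that trop_inner_upper[of x j z] by (simp add: I_def less_le)
  then have "x \<in> P1_cell P z I (- I)"
    unfolding P1_cell_iff[OF z] using \<open>x \<in> P\<close> by (simp add: I_def)
  moreover have "y \<in> P2_cell Q z I (- I)"
    unfolding P2_cell_iff[OF z le] using \<open>y \<in> Q\<close> i by (auto simp: I_def)
  ultimately show ?L by (intro exI[of _ I] exI[of _ "- I"]) auto
qed

theorem theorem2p2:
  fixes P1 P2 :: "(ereal ^ 'n::finite) set" and ymax :: "ereal ^ 'n"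
  assumes "trop_polyhedron P1" and "trop_compact P1"
    and "trop_polyhedron P2" and "trop_compact P2"
    and "greatest_point P2 ymax" and "\<forall>i. \<bar>ymax $ i\<bar> \<noteq> \<infinity>"
  shows "(trop_bot \<notin> P1 \<longrightarrow>
            {(x, y) \<in> P1 \<times> P2. trop_inner x y = trop_inner x ymax} =
            (\<Union>(I, J) \<in> {(I, J). I \<inter> J = {} \<and> I \<union> J = UNIV}.
               P1_cell P1 ymax I J \<times> P2_cell P2 ymax I J)) \<and>
         {(x, y) \<in> P1 \<times> P2. trop_inner x y = trop_inner x ymax} =
            (\<Union>(I, J) \<in> {(I, J). I \<inter> J = {} \<and> I \<union> J = UNIV}.
               P1_cell P1 ymax I J \<times> P2_cell P2 ymax I J) \<union> (P1 \<inter> {trop_bot}) \<times> P2"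
proof -
  define v where "v i = real_of_ereal (ymax $ i)" for i
  have z: "ymax $ i = ereal (v i)" for i
    using assms(6) by (simp add: v_def ereal_real)
  have le: "\<forall>y \<in> P2. \<forall>i. y $ i \<le> ymax $ i"
    using assms(5) by (simp add: greatest_point_def)
  have P1: "P1 \<subseteq> rmax_space"
    using assms(1) by (auto simp: trop_polyhedron_def)
  let ?L = "{(x, y) \<in> P1 \<times> P2. trop_inner x y = trop_inner x ymax}"
  let ?U = "\<Union>(I, J) \<in> {(I, J). I \<inter> J = {} \<and> I \<union> J = UNIV}.
    P1_cell P1 ymax I J \<times> P2_cell P2 ymax I J"
  have U: "(x, y) \<in> ?U \<longleftrightarrow> x \<in> P1 \<and> y \<in> P2 \<and>
      (\<exists>i. y $ i = ymax $ i \<and> x $ i + ymax $ i = trop_inner x ymax)" for x y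
  proof (cases "x \<in> P1 \<and> y \<in> P2")
    case True
    then show ?thesis using ex_cell_iff[OF z le, of x P1 y] by auto
  qed (auto simp: P1_cell_def P2_cell_def)
  have L: "(x, y) \<in> ?L \<longleftrightarrow> x \<in> P1 \<and> y \<in> P2 \<and>
      (x = trop_bot \<or> (\<exists>i. y $ i = ymax $ i \<and> x $ i + ymax $ i = trop_inner x ymax))" for x y
    using trop_inner_eq_iff[OF _ z, of x y] le P1 by blast
  \<comment> \<open>The two sets \<open>?L\<close> and \<open>?U\<close> can differ only in pairs
    with \<open>x = trop_bot\<close>, and the extra block contains all of these.\<close>
  have *: "(x, y) \<in> ?L \<longleftrightarrow> (x, y) \<in> ?U \<union> (P1 \<inter> {trop_bot}) \<times> P2" for x y
    unfolding L Un_iff U by blast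
  have main: "?L = ?U \<union> (P1 \<inter> {trop_bot}) \<times> P2"
    by (intro equalityI subrelI; simp only: *)
  moreover have "?L = ?U" if "trop_bot \<notin> P1"
    using main that by simp
  ultimately show ?thesis by blast
qed

end
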